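(* Let $w\in\mathbb{D}$ and let $$d\nu_w(z):=\frac{1-|w|^{2}}{|z-w|^{2}}\,d\mu(z)$$ be the harmonic measure on $\mathbb{S}^1$ with pole at $w$. Let $\phi$ be a finite Blaschke product. Then $\phi$ preserves $\nu_w$ (i.e. $\phi_*\nu_w=\nu_w$) if and only if $\phi(w)=w$.
   Context: $\mathbb{D}$ is the open unit disk, $\mathbb{S}^1=\{|z|=1\}$, $d\mu(z)=\frac{1}{2\pi i}\frac{dz}{z}$ is normalized Lebesgue measure on $\mathbb{S}^1$. A finite Blaschke product is a map $\phi(z)=e^{i\psi}\prod_{i=1}^q\frac{z-\lambda_i}{1-\overline{\lambda_i}z}$ with $\psi\in[0,2\pi)$, $|\lambda_i|<1$, $q\ge1$; it maps $\mathbb{S}^1$ to itself and $\mathbb{D}$ to itself. *)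

theory Defs
  imports "HOL-Analysis.Analysis"
begin

(* Normalized Lebesgue measure on the unit circle, on the Borel sets of the circle:
   for z = exp (i t) one has dz / (2 pi i z) = dt / (2 pi). *)
definition circle_measure :: "complex measure" where
  "circle_measure =
     distr (uniform_measure lborel {0..<2 * pi}) (restrict_space borel (sphere 0 1)) cis"

definition harmonic_measure :: "complex \<Rightarrow> complex measure" where
  "harmonic_measure w =
     density circle_measure (\<lambda>z. ennreal ((1 - (cmod w)\<^sup>2) / (cmod (z - w))\<^sup>2))"

(* A finite Blaschke product is regarded as a map on the closed unit disk; the values
   outside (where the formula has poles) are left unconstrained. *)
definition finite_blaschke_product :: "(complex \<Rightarrow> complex) \<Rightarrow> bool" where
  "finite_blaschke_product \<phi> \<longleftrightarrow>
     (\<exists>(\<psi>::real) (q::nat) (a::nat \<Rightarrow> complex).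
        0 \<le> \<psi> \<and> \<psi> < 2 * pi \<and> 1 \<le> q \<and> (\<forall>i\<in>{1..q}. cmod (a i) < 1) \<and>
        (\<forall>z\<in>cball 0 1. \<phi> z = cis \<psi> * (\<Prod>i=1..q. (z - a i) / (1 - cnj (a i) * z))))"

end

theory Submission
  imports Defs "HOL-Complex_Analysis.Complex_Analysis"
begin

text \<open>
  Harmonic measure \<open>\<nu>\<^sub>w\<close> represents evaluation at \<open>w\<close>: if \<open>f\<close> is continuous on the closed disk
  and holomorphic inside, then \<open>\<integral> f d\<nu>\<^sub>w = f w\<close>
  (\<open>harmonic_measure_holomorphic_integral\<close>, from Cauchy's integral formula). A finite Blaschke
  product \<open>\<phi>\<close> and all its powers are of this kind, and \<open>\<phi>\<close> maps the circle to itself, so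
  the push-forward of \<open>\<nu>\<^sub>w\<close> along \<open>\<phi>\<close> has the moments \<open>\<integral> \<phi>\<^sup>n d\<nu>\<^sub>w = (\<phi> w)\<^sup>n\<close>,
  while \<open>\<nu>\<^sub>w\<close> itself has the moments \<open>w\<^sup>n\<close>.

  If \<open>\<phi>\<close> preserves \<open>\<nu>\<^sub>w\<close>, comparing first moments gives \<open>\<phi> w = w\<close>. Conversely, if
  \<open>\<phi> w = w\<close>, all moments with \<open>n \<ge> 0\<close> agree. Both measures are real, so the
  negative Fourier coefficients, being complex conjugates of the positive ones, agree too, and a
  finite measure on the circle is determined by its Fourier coefficients
  (\<open>circle_measure_eqI_moments\<close>, by the Stone-Weierstrass theorem).
\<close>

section \<open>Measures determined by integrals of continuous functions\<close>

text \<open>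
  Closed sets form an intersection-stable generator of the Borel sets, and the indicator of a closed
  set \<open>C\<close> is the limit of the continuous functions \<open>max 0 (1 - n * infdist x C)\<close>, all
  dominated by \<open>1\<close>.
\<close>

lemma borel_measure_eqI_continuous:
  fixes M N :: "'a::metric_space measure"
  assumes sets: "sets M = sets borel" "sets N = sets borel"
    and fin: "finite_measure M" "finite_measure N"
    and eq: "\<And>f :: 'a \<Rightarrow> real. \<lbrakk>continuous_on UNIV f; \<And>x. 0 \<le> f x; \<And>x. f x \<le> 1\<rbrakk>
               \<Longrightarrow> (\<integral>x. f x \<partial>M) = (\<integral>x. f x \<partial>N)"
  shows "M = N"
proof -
  define g :: "'a set \<Rightarrow> nat \<Rightarrow> 'a \<Rightarrow> real"
    where "g C n x = max 0 (1 - real n * infdist x C)" for C n x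
  have cont: "continuous_on UNIV (g C n)" for C n
    unfolding g_def by (intro continuous_intros)
  have bounds: "0 \<le> g C n x" "g C n x \<le> 1" for C n x
    by (auto simp: g_def infdist_nonneg)
  \<comment> \<open>The case \<open>C = {}\<close> is kept apart because \<open>infdist x {} = 0\<close>.\<close>
  have lim: "(\<lambda>n. g C n x) \<longlonglongrightarrow> indicator C x" if "closed C" "C \<noteq> {}" for C x
  proof (cases "x \<in> C")
    case True
    then show ?thesis by (simp add: g_def)
  next
    case False
    with that have "infdist x C > 0"
      by (metis in_closed_iff_infdist_zero infdist_nonneg less_eq_real_def)
    then obtain n0 where "1 < real n0 * infdist x C"
      using reals_Archimedean3 by blast
    then have "g C n x = 0" if "n \<ge> n0" for n
      using mult_right_mono[of "real n0" "real n" "infdist x C"] that infdist_nonneg[of x C]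
      by (auto simp: g_def)
    then have "eventually (\<lambda>n. g C n x = indicator C x) sequentially"
      using False by (auto simp: eventually_sequentially)
    then show ?thesis
      by (rule tendsto_eventually)
  qed
  have meas: "(\<lambda>n. \<integral>x. g C n x \<partial>L) \<longlonglongrightarrow> measure L C"
    if C: "closed C" "C \<noteq> {}" and L: "sets L = sets borel" "finite_measure L" for C L
  proof -
    interpret L: finite_measure L by fact
    have [measurable]: "C \<in> sets L" using C L by auto
    have [measurable]: "g C n \<in> borel_measurable L" for n
      using borel_measurable_continuous_onI[OF cont] measurable_cong_sets[OF L(1) refl] by blast
    have "(\<lambda>n. \<integral>x. g C n x \<partial>L) \<longlonglongrightarrow> (\<integral>x. indicator C x \<partial>L)"
      by (rule integral_dominated_convergence[where w="\<lambda>_. 1"])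
         (use lim[OF C] bounds in auto)
    then show ?thesis
      using sets_eq_imp_space_eq[OF L(1)] by simp
  qed
  interpret M: finite_measure M by fact
  interpret N: finite_measure N by fact
  have "measure M C = measure N C" if "closed C" for C
  proof (cases "C = {}")
    case False
    have "(\<integral>x. g C n x \<partial>M) = (\<integral>x. g C n x \<partial>N)" for n
      by (intro eq cont bounds)
    then show ?thesis
      using meas[OF that False sets(1) fin(1)] meas[OF that False sets(2) fin(2)]
        LIMSEQ_unique by simp
  qed simp
  then show ?thesis
    by (intro measure_eqI_generator_eq[where E="Collect closed" and \<Omega>=UNIV and A="\<lambda>_. UNIV"])
       (auto simp: Int_stable_def sets borel_eq_closed M.emeasure_eq_measure N.emeasure_eq_measure)
qed

lemma integrable_continuous_on_compact:
  fixes f :: "'a::topological_space \<Rightarrow> 'b::{banach, second_countable_topology}"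
  assumes "compact S"
    and sets: "sets M = sets (restrict_space borel S)"
    and "finite_measure M"
    and f: "continuous_on S f"
  shows "integrable M f"
proof -
  interpret finite_measure M by fact
  have "space M = S"
    using sets_eq_imp_space_eq[OF sets] by (auto simp: space_restrict_space)
  moreover have "f \<in> borel_measurable M"
    using borel_measurable_continuous_on_restrict[OF f] measurable_cong_sets[OF sets refl] by blast
  moreover obtain B where "\<And>x. x \<in> S \<Longrightarrow> norm (f x) \<le> B"
    using compact_imp_bounded[OF compact_continuous_image[OF f \<open>compact S\<close>]]
    by (auto simp: bounded_iff)
  ultimately show ?thesis
    by (intro integrable_const_bound[where B=B] AE_I2) auto
qed

text \<open>
  By the Stone-Weierstrass theorem, every continuous function is uniformly close on \<open>S\<close> to a
  polynomial, so that equality of integrals passes from polynomials to continuous functions.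
\<close>

lemma compact_measure_eqI_polynomial:
  fixes M N :: "'a::euclidean_space measure"
  assumes S: "compact S"
    and sets: "sets M = sets (restrict_space borel S)" "sets N = sets (restrict_space borel S)"
    and fin: "finite_measure M" "finite_measure N"
    and eq: "\<And>p. real_polynomial_function p \<Longrightarrow> (\<integral>x. p x \<partial>M) = (\<integral>x. p x \<partial>N)"
  shows "M = N"
proof -
  interpret M: finite_measure M by fact
  interpret N: finite_measure N by fact
  have [measurable]: "S \<in> sets borel" using S by (simp add: compact_imp_closed)
  have space: "space M = S" "space N = S"
    using sets_eq_imp_space_eq[OF sets(1)] sets_eq_imp_space_eq[OF sets(2)]
    by (auto simp: space_restrict_space)
  have id: "(\<lambda>x. x) \<in> measurable L borel" if "sets L = sets (restrict_space borel S)"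
    for L :: "'a measure"
    using measurable_cong_sets[OF that refl, of borel] measurable_restrict_space1[of "\<lambda>x. x" borel borel S] by auto
  note idM = id[OF sets(1)] and idN = id[OF sets(2)]
  note int = integrable_continuous_on_compact[OF S]
  \<comment> \<open>Regarded as measures on the whole space, \<open>M\<close> and \<open>N\<close> can be compared by globally
     continuous functions.\<close>
  have "distr M borel (\<lambda>x. x) = distr N borel (\<lambda>x. x)"
  proof (rule borel_measure_eqI_continuous)
    fix f :: "'a \<Rightarrow> real"
    assume f: "continuous_on UNIV f"
    then have fm: "f \<in> borel_measurable borel" and fS: "continuous_on S f"
      by (auto intro: borel_measurable_continuous_onI continuous_on_subset)
    have close: "\<bar>(\<integral>x. f x \<partial>M) - (\<integral>x. f x \<partial>N)\<bar> \<le> e * (measure M S + measure N S)" if e: "e > 0" for e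
    proof -
      obtain p where p: "real_polynomial_function p" "\<And>x. x \<in> S \<Longrightarrow> \<bar>f x - p x\<bar> < e"
        using Stone_Weierstrass_real_polynomial_function[OF S fS e] by blast
      have pS: "continuous_on S p"
        using continuous_on_polymonial_function p(1) real_polynomial_function_eq by blast
      have bd: "\<bar>(\<integral>x. f x \<partial>L) - (\<integral>x. p x \<partial>L)\<bar> \<le> e * measure L S"
        if L: "sets L = sets (restrict_space borel S)" "finite_measure L" for L
      proof -
        interpret L: finite_measure L by fact
        have sp: "space L = S" using sets_eq_imp_space_eq[OF L(1)] by (auto simp: space_restrict_space)
        note i = int[OF L fS] int[OF L pS]
        have "\<bar>(\<integral>x. f x \<partial>L) - (\<integral>x. p x \<partial>L)\<bar> = \<bar>\<integral>x. f x - p x \<partial>L\<bar>"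
          using i by simp
        also have "\<dots> \<le> (\<integral>x. \<bar>f x - p x\<bar> \<partial>L)"
          by (rule integral_abs_bound)
        also have "\<dots> \<le> (\<integral>x. e \<partial>L)"
          by (rule integral_mono) (use i p(2) in \<open>auto simp: sp less_imp_le\<close>)
        finally show ?thesis by (simp add: sp mult.commute)
      qed
      show ?thesis
        using bd[OF sets(1) fin(1)] bd[OF sets(2) fin(2)] eq[OF p(1)] by (simp add: distrib_left)
    qed
    \<comment> \<open>The extra \<open>1\<close> in the denominator keeps it positive when both measures vanish.\<close>
    have "\<bar>(\<integral>x. f x \<partial>M) - (\<integral>x. f x \<partial>N)\<bar> \<le> 0 + d" if "d > 0" for d
    proof -
      let ?m = "measure M S + measure N S"
      have m: "0 \<le> ?m" by (simp add: add_nonneg_nonneg)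
      then have "?m / (?m + 1) \<le> 1"
        by (intro divide_le_eq_1_pos[THEN iffD2]) linarith+
      then have "d / (?m + 1) * ?m \<le> d"
        using mult_left_mono[of "?m / (?m + 1)" 1 d] that by simp
      moreover have "0 < d / (?m + 1)"
        using m that by (intro divide_pos_pos) linarith+
      ultimately show ?thesis
        using close[of "d / (?m + 1)"] by linarith
    qed
    then have "\<bar>(\<integral>x. f x \<partial>M) - (\<integral>x. f x \<partial>N)\<bar> \<le> 0"
      by (rule field_le_epsilon)
    then have "(\<integral>x. f x \<partial>M) = (\<integral>x. f x \<partial>N)"
      by simp
    then show "(\<integral>x. f x \<partial>distr M borel (\<lambda>x. x)) = (\<integral>x. f x \<partial>distr N borel (\<lambda>x. x))"
      by (simp add: integral_distr idM idN fm)
  qed (auto intro: M.finite_measure_distr N.finite_measure_distr idM idN)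
  then have d: "emeasure (distr M borel (\<lambda>x. x)) A = emeasure (distr N borel (\<lambda>x. x)) A" for A
    by simp
  show ?thesis
  proof (rule measure_eqI)
    fix A assume A: "A \<in> sets M"
    then have "A \<in> sets borel" "A \<subseteq> S"
      using sets by (auto simp: sets_restrict_space)
    then show "emeasure M A = emeasure N A"
      using d[of A] by (simp add: emeasure_distr idM idN space Int_absorb2)
  qed (simp add: sets)
qed

section \<open>Measures on the circle are determined by their moments\<close>

text \<open>
  On the circle \<open>z * cnj z = 1\<close>, so that every monomial \<open>z\<^sup>i * (cnj z)\<^sup>j\<close> is a power of
  \<open>z\<close> or the conjugate of one; hence the given moments fix the integrals of all these monomials,
  and with them those of all real polynomials in \<open>Re z\<close> and \<open>Im z\<close>.
\<close>

lemma circle_measure_eqI_moments: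
  fixes M N :: "complex measure"
  assumes sets: "sets M = sets (restrict_space borel (sphere 0 1))"
                "sets N = sets (restrict_space borel (sphere 0 1))"
    and fin: "finite_measure M" "finite_measure N"
    and moments: "\<And>n. (\<integral>z. z ^ n \<partial>M) = (\<integral>z. z ^ n \<partial>N)"
  shows "M = N"
proof (rule compact_measure_eqI_polynomial[OF _ sets fin])
  show "compact (sphere 0 1 :: complex set)" by simp
  let ?S = "sphere 0 1 :: complex set"
  have sp: "space L = ?S" if "sets L = sets (restrict_space borel ?S)" for L
    using sets_eq_imp_space_eq[OF that] by (auto simp: space_restrict_space)
  note int = integrable_continuous_on_compact[OF compact_sphere]
  \<comment> \<open>That \<open>p\<close> and \<open>q\<close> each have the same integral under \<open>M\<close> and \<open>N\<close> says nothing about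
     their product, so a direct induction over polynomials fails. Instead, the induction shows
     that multiplication by a polynomial maps \<open>K\<close> to itself; products inherit this property
     by composition.\<close>
  define K where "K = {g. continuous_on ?S g \<and>
     (\<forall>i j. (\<integral>z. g z * (z ^ i * cnj z ^ j) \<partial>M) = (\<integral>z. g z * (z ^ i * cnj z ^ j) \<partial>N))}"
  define multiplier where "multiplier p \<longleftrightarrow> (\<forall>g\<in>K. (\<lambda>z. p z * g z) \<in> K)" for p :: "complex \<Rightarrow> complex"
  have cont_mono: "continuous_on ?S (\<lambda>z. g z * (z ^ i * cnj z ^ j))" if "continuous_on ?S g" for g i j
    using that by (intro continuous_intros)
  have mono: "(\<integral>z. z ^ i * cnj z ^ j \<partial>M) = (\<integral>z. z ^ i * cnj z ^ j \<partial>N)" for i j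
  proof -
    have one: "z * cnj z = 1" if "z \<in> ?S" for z
      using that by (simp add: complex_norm_square[symmetric])
    have pw: "z ^ k * cnj z ^ k = 1" if "z \<in> ?S" for z k
      using one[OF that] by (simp flip: power_mult_distrib)
    consider "j \<le> i" | "i \<le> j" by linarith
    then show ?thesis
    proof cases
      case 1
      have "z ^ i * cnj z ^ j = z ^ (i - j)" if "z \<in> ?S" for z
        using pw[OF that, of j] 1
        by (metis le_add_diff_inverse2 mult.assoc mult.right_neutral power_add)
      then have "(\<integral>z. z ^ i * cnj z ^ j \<partial>L) = (\<integral>z. z ^ (i - j) \<partial>L)"
        if "sets L = sets (restrict_space borel ?S)" for L
        by (intro Bochner_Integration.integral_cong) (use sp[OF that] in auto)
      then show ?thesis using sets moments by simp
    next
      case 2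
      have "z ^ i * cnj z ^ j = cnj (z ^ (j - i))" if "z \<in> ?S" for z
        using pw[OF that, of i] 2
        by (metis complex_cnj_power le_add_diff_inverse mult.assoc mult.left_neutral power_add)
      then have "(\<integral>z. z ^ i * cnj z ^ j \<partial>L) = (\<integral>z. cnj (z ^ (j - i)) \<partial>L)"
        if "sets L = sets (restrict_space borel ?S)" for L
        by (intro Bochner_Integration.integral_cong) (use sp[OF that] in auto)
      then show ?thesis using sets moments by (simp del: complex_cnj_power)
    qed
  qed
  have oneK: "(\<lambda>_. 1) \<in> K"
    using mono by (simp add: K_def)
  have lin: "(\<lambda>z. a * g z + b * h z) \<in> K" if "g \<in> K" "h \<in> K" for a b g h
  proof -
    have c: "continuous_on ?S g" "continuous_on ?S h"
      using that by (auto simp: K_def)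
    have e: "(\<integral>z. (a * g z + b * h z) * (z ^ i * cnj z ^ j) \<partial>L)
       = a * (\<integral>z. g z * (z ^ i * cnj z ^ j) \<partial>L) + b * (\<integral>z. h z * (z ^ i * cnj z ^ j) \<partial>L)"
      if "sets L = sets (restrict_space borel ?S)" "finite_measure L" for L i j
      using int[OF that cont_mono[OF c(1)], of i j] int[OF that cont_mono[OF c(2)], of i j]
      by (simp add: distrib_right mult.assoc)
    show ?thesis
      using that c e[OF sets(1) fin(1)] e[OF sets(2) fin(2)]
      by (auto simp: K_def intro!: continuous_intros)
  qed
  have Z: "(\<lambda>z. z * g z) \<in> K" and Zc: "(\<lambda>z. cnj z * g z) \<in> K" if "g \<in> K" for g
  proof -
    have c: "continuous_on ?S g"
      and e: "(\<integral>z. g z * (z ^ i * cnj z ^ j) \<partial>M) = (\<integral>z. g z * (z ^ i * cnj z ^ j) \<partial>N)" for i j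
      using that by (auto simp: K_def)
    have "(\<integral>z. z * g z * (z ^ i * cnj z ^ j) \<partial>L) = (\<integral>z. g z * (z ^ Suc i * cnj z ^ j) \<partial>L)"
      "(\<integral>z. cnj z * g z * (z ^ i * cnj z ^ j) \<partial>L) = (\<integral>z. g z * (z ^ i * cnj z ^ Suc j) \<partial>L)"
      for i j and L :: "complex measure"
      by (simp_all add: mult_ac)
    then show "(\<lambda>z. z * g z) \<in> K" "(\<lambda>z. cnj z * g z) \<in> K"
      unfolding K_def using c
      by (simp_all only: mem_Collect_eq e) (auto intro!: continuous_intros)
  qed
  fix p :: "complex \<Rightarrow> real"
  assume "real_polynomial_function p"
  then have "multiplier (\<lambda>z. of_real (p z))"
  proof induction
    case (linear f)
    interpret bounded_linear f by fact
    \<comment> \<open>A real-linear functional on the plane is a complex combination of \<open>z\<close> and \<open>cnj z\<close>.\<close>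
    have f: "of_real (f z) = ((of_real (f 1) - \<i> * of_real (f \<i>)) / 2) * z
        + ((of_real (f 1) + \<i> * of_real (f \<i>)) / 2) * cnj z" for z
    proof -
      have "f z = f (Re z *\<^sub>R 1 + Im z *\<^sub>R \<i>)"
        by (rule arg_cong[of _ _ f]) (simp add: complex_eq_iff)
      also have "\<dots> = Re z * f 1 + Im z * f \<i>"
        by (simp only: add scaleR) simp
      finally show ?thesis by (simp add: complex_eq_iff field_simps)
    qed
    show ?case
      unfolding multiplier_def
    proof
      fix g assume g: "g \<in> K"
      have "(\<lambda>z. of_real (f z) * g z) =
          (\<lambda>z. (of_real (f 1) - \<i> * of_real (f \<i>)) / 2 * (z * g z)
             + (of_real (f 1) + \<i> * of_real (f \<i>)) / 2 * (cnj z * g z))"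
        by (rule ext, subst f) (simp only: distrib_right mult.assoc)
      then show "(\<lambda>z. of_real (f z) * g z) \<in> K"
        by (simp only: lin[OF Z[OF g] Zc[OF g]])
    qed
  next
    case (const c)
    show ?case
      unfolding multiplier_def
    proof
      fix g assume "g \<in> K"
      then show "(\<lambda>z. of_real c * g z) \<in> K"
        using lin[of g g "of_real c" 0] by simp
    qed
  next
    case (add f g)
    show ?case
      unfolding multiplier_def
    proof
      fix h assume "h \<in> K"
      then have "(\<lambda>z. of_real (f z) * h z) \<in> K" "(\<lambda>z. of_real (g z) * h z) \<in> K"
        using add.IH by (auto simp: multiplier_def)
      then show "(\<lambda>z. of_real (f z + g z) * h z) \<in> K"
        using lin[of "\<lambda>z. of_real (f z) * h z" "\<lambda>z. of_real (g z) * h z" 1 1]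
        by (simp add: distrib_right)
    qed
  next
    case (mult f g)
    show ?case
      unfolding multiplier_def
    proof
      fix h assume "h \<in> K"
      then have "(\<lambda>z. of_real (f z) * (of_real (g z) * h z)) \<in> K"
        using mult.IH unfolding multiplier_def by fast
      then show "(\<lambda>z. of_real (f z * g z) * h z) \<in> K"
        by (simp add: mult.assoc)
    qed
  qed
  then have "(\<lambda>z. of_real (p z)) \<in> K"
    using oneK by (force simp: multiplier_def)
  then have "(\<integral>z. complex_of_real (p z) \<partial>M) = (\<integral>z. complex_of_real (p z) \<partial>N)"
    unfolding K_def by (auto dest!: spec[of _ 0])
  then show "(\<integral>z. p z \<partial>M) = (\<integral>z. p z \<partial>N)"
    by simp
qed

section \<open>Harmonic measure\<close>

lemma cis_measurable_circle [measurable]: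
  "cis \<in> measurable borel (restrict_space borel (sphere 0 1))"
  by (rule measurable_restrict_space2)
     (auto intro!: borel_measurable_continuous_onI continuous_intros)

lemma sets_harmonic_measure: "sets (harmonic_measure w) = sets (restrict_space borel (sphere 0 1))"
  by (simp add: harmonic_measure_def circle_measure_def)

lemma circle_measure_eq_density:
  "circle_measure = distr (density lborel (\<lambda>t. ennreal (indicator {0..<2*pi} t / (2 * pi))))
     (restrict_space borel (sphere 0 1)) cis"
proof -
  have "(\<lambda>t. indicator {0..<2*pi} t / emeasure lborel {0..<2*pi})
      = (\<lambda>t. ennreal (indicator {0..<2*pi} t / (2 * pi)))"
    by (auto simp: fun_eq_iff indicator_def divide_ennreal simp flip: ennreal_1)
  then show ?thesis
    by (simp add: circle_measure_def uniform_measure_def)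
qed

text \<open>
  The passage from \<open>circle_measure\<close> to a gauge integral over the closed parameter interval, the
  form in which contour integrals around the circle are available.
\<close>

lemma integral_circle_measure:
  fixes f :: "complex \<Rightarrow> complex"
  assumes f: "continuous_on (sphere 0 1) f"
    and I: "((\<lambda>t. f (cis t)) has_integral I) {0..2*pi}"
  shows "(\<integral>z. f z \<partial>circle_measure) = I / (2 * pi)"
proof -
  have [measurable]: "f \<in> borel_measurable (restrict_space borel (sphere 0 1))"
    using f by (rule borel_measurable_continuous_on_restrict)
  have c: "continuous_on {0..2*pi} (\<lambda>t. f (cis t))"
    by (rule continuous_on_compose2[OF f]) (auto intro!: continuous_intros)
  have si: "set_integrable lborel {0..2*pi} (\<lambda>t. f (cis t))"
    using borel_integrable_atLeastAtMost'[OF c] .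
  have "(\<integral>z. f z \<partial>circle_measure) =
      (\<integral>t. (indicator {0..<2*pi} t / (2 * pi)) *\<^sub>R f (cis t) \<partial>lborel)"
    by (simp add: circle_measure_eq_density integral_distr integral_density)
  also have "\<dots> = (\<integral>t. (indicator {0..2*pi} t *\<^sub>R f (cis t)) / (2 * pi) \<partial>lborel)"
    by (rule integral_cong_AE)
       (auto intro!: eventually_mono[OF AE_lborel_singleton[of "2*pi"]]
             simp: indicator_def scaleR_conv_of_real)
  also have "\<dots> = (LINT t:{0..2*pi}|lborel. f (cis t)) / (2 * pi)"
    by (simp add: set_lebesgue_integral_def)
  also have "(LINT t:{0..2*pi}|lborel. f (cis t)) = I"
    using set_borel_integral_eq_integral(2)[OF si] I by (simp add: integral_unique)
  finally show ?thesis .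
qed

lemma one_minus_cnj_mult_nonzero:
  fixes a z :: complex
  assumes "cmod a < 1" "cmod z \<le> 1"
  shows "1 - cnj a * z \<noteq> 0"
proof
  assume "1 - cnj a * z = 0"
  then have "cmod (cnj a * z) = 1" by simp
  moreover have "cmod a * cmod z < 1"
    using assms mult_left_le[of "cmod z" "cmod a"] by simp
  ultimately show False by (simp add: norm_mult)
qed

lemma one_minus_cnj_mult_on_circle:
  fixes a z :: complex
  assumes "cmod z = 1"
  shows "1 - cnj a * z = z * cnj (z - a)"
proof -
  have "z * cnj z = 1"
    using assms by (simp add: complex_norm_square[symmetric])
  then show ?thesis by (simp add: algebra_simps)
qed

lemma poisson_kernel_continuous:
  assumes "cmod w < 1"
  shows "continuous_on (sphere 0 1) (\<lambda>z. (1 - (cmod w)\<^sup>2) / (cmod (z - w))\<^sup>2)"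
  using assms by (intro continuous_intros) auto

text \<open>
  On the circle \<open>cnj (z - w) = (1 - cnj w * z) / z\<close>, which turns the squared modulus in the
  Poisson kernel into a rational function of \<open>z\<close>. For \<open>cmod w < 1\<close> its only pole in the disk
  is \<open>w\<close>.
\<close>

lemma poisson_kernel_eq:
  assumes "cmod z = 1"
  shows "complex_of_real ((1 - (cmod w)\<^sup>2) / (cmod (z - w))\<^sup>2)
       = (1 - cnj w * w) * z / ((1 - cnj w * z) * (z - w))"
proof -
  have "z \<noteq> 0" using assms by auto
  have "complex_of_real ((1 - (cmod w)\<^sup>2) / (cmod (z - w))\<^sup>2)
      = (1 - w * cnj w) / ((z - w) * cnj (z - w))"
    by (simp only: of_real_divide of_real_diff of_real_1 complex_norm_square)
  also have "\<dots> = z * (1 - w * cnj w) / (z * ((z - w) * cnj (z - w)))"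
    by (rule mult_divide_mult_cancel_left[symmetric]) fact
  also have "z * ((z - w) * cnj (z - w)) = (1 - cnj w * z) * (z - w)"
    unfolding one_minus_cnj_mult_on_circle[OF assms] by (simp only: mult_ac)
  finally show ?thesis
    by (simp only: mult.commute)
qed

text \<open>
  With the Poisson kernel written as a rational function, the integral becomes the Cauchy integral
  at \<open>w\<close> of \<open>h z = (1 - cnj w * w) * f z / (1 - cnj w * z)\<close>, and \<open>h w = f w\<close>.
\<close>

lemma harmonic_measure_holomorphic_integral:
  assumes w: "cmod w < 1"
    and f: "continuous_on (cball 0 1) f" "f holomorphic_on ball 0 1"
  shows "(\<integral>z. f z \<partial>harmonic_measure w) = f w"
proof -
  let ?P = "\<lambda>z. (1 - (cmod w)\<^sup>2) / (cmod (z - w))\<^sup>2"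
  define h where "h z = (1 - cnj w * w) * f z / (1 - cnj w * z)" for z
  note nz = one_minus_cnj_mult_nonzero[OF w]
  have "continuous_on (cball 0 1) h" "h holomorphic_on ball 0 1"
    unfolding h_def using nz
    by (auto intro!: continuous_intros holomorphic_intros f)
  then have "((\<lambda>u. h u / (u - w)) has_contour_integral (2 * of_real pi * \<i> * h w)) (circlepath 0 1)"
    using w by (intro Cauchy_integral_circlepath) auto
  moreover have "h w = f w"
    using nz[of w] w by (simp add: h_def)
  ultimately have "((\<lambda>t. h (cis t) / (cis t - w) * \<i> * cis t) has_integral (2 * of_real pi * \<i> * f w)) {0..2*pi}"
    by (simp add: circlepath_def has_contour_integral_part_circlepath_iff)
  \<comment> \<open>Along the circle \<open>dz = \<i> * z * dt\<close>; the factor \<open>- \<i>\<close> removes the \<open>\<i>\<close>, and the remaining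
     \<open>z\<close> is the one in the numerator of the Poisson kernel.\<close>
  then have "((\<lambda>t. - \<i> * (h (cis t) / (cis t - w) * \<i> * cis t)) has_integral - \<i> * (2 * of_real pi * \<i> * f w)) {0..2*pi}"
    by (rule has_integral_mult_right)
  moreover have "- \<i> * (h (cis t) / (cis t - w) * \<i> * cis t) = complex_of_real (?P (cis t)) * f (cis t)" for t
    by (subst poisson_kernel_eq) (use w in \<open>auto simp: h_def field_simps\<close>)
  ultimately have I: "((\<lambda>t. complex_of_real (?P (cis t)) * f (cis t)) has_integral 2 * of_real pi * f w) {0..2*pi}"
    by (simp add: mult_ac)
  have fS: "continuous_on (sphere 0 1) f"
    using f(1) by (rule continuous_on_subset) auto
  have [measurable]: "f \<in> borel_measurable circle_measure" "?P \<in> borel_measurable circle_measure"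
    using borel_measurable_continuous_on_restrict[OF fS]
      borel_measurable_continuous_on_restrict[OF poisson_kernel_continuous[OF w]]
    by (simp_all add: circle_measure_def)
  have Pnn: "0 \<le> ?P z" for z
    using w by (simp add: power_le_one)
  have "(\<integral>z. f z \<partial>harmonic_measure w) = (\<integral>z. ?P z *\<^sub>R f z \<partial>circle_measure)"
    unfolding harmonic_measure_def by (rule integral_density) (use Pnn in auto)
  also have "\<dots> = (\<integral>z. complex_of_real (?P z) * f z \<partial>circle_measure)"
    by (simp only: scaleR_conv_of_real)
  also have "\<dots> = 2 * of_real pi * f w / (2 * pi)"
    by (rule integral_circle_measure[OF _ I])
       (intro continuous_on_mult continuous_on_of_real poisson_kernel_continuous w fS)
  finally show ?thesis by simp
qed

text \<open>
  The representation property for \<open>f = 1\<close> gives total mass \<open>1\<close>. This rules out infinite mass,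
  because \<open>measure\<close> assigns \<open>0\<close> to a set of infinite measure.
\<close>

lemma finite_measure_harmonic_measure:
  assumes w: "cmod w < 1"
  shows "finite_measure (harmonic_measure w)"
proof -
  have "(\<integral>z. (1::complex) \<partial>harmonic_measure w) = 1"
    by (rule harmonic_measure_holomorphic_integral) (use w in auto)
  then have "measure (harmonic_measure w) (space (harmonic_measure w)) \<noteq> 0"
    by auto
  then show ?thesis
    by (intro finite_measureI) (auto simp: measure_def)
qed

section \<open>Blaschke products\<close>

lemma norm_blaschke_factor:
  assumes "cmod z = 1" "cmod a < 1"
  shows "cmod ((z - a) / (1 - cnj a * z)) = 1"
proof -
  have "cmod (1 - cnj a * z) = cmod (z - a)"
    using assms one_minus_cnj_mult_on_circle[of z a] by (simp add: norm_mult del: complex_cnj_diff)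
  moreover have "z \<noteq> a" using assms by auto
  ultimately show ?thesis by (simp add: norm_divide)
qed

lemma finite_blaschke_product_properties:
  assumes "finite_blaschke_product \<phi>"
  shows "continuous_on (cball 0 1) \<phi>" "\<phi> holomorphic_on ball 0 1"
    and "\<And>z. cmod z = 1 \<Longrightarrow> cmod (\<phi> z) = 1"
proof -
  obtain \<psi> q a where a: "\<And>i. i \<in> {1..q} \<Longrightarrow> cmod (a i) < 1"
    and \<phi>: "\<And>z. z \<in> cball 0 1 \<Longrightarrow> \<phi> z = cis \<psi> * (\<Prod>i=1..q::nat. (z - a i) / (1 - cnj (a i) * z))"
    using assms unfolding finite_blaschke_product_def by blast
  have nz: "1 - cnj (a i) * z \<noteq> 0" if "cmod z \<le> 1" "i \<in> {1..q}" for z i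
    using one_minus_cnj_mult_nonzero a that by blast
  let ?B = "\<lambda>z. cis \<psi> * (\<Prod>i=1..q. (z - a i) / (1 - cnj (a i) * z))"
  have "continuous_on (cball 0 1) ?B"
    by (intro continuous_intros) (use nz in auto)
  then show "continuous_on (cball 0 1) \<phi>"
    by (subst continuous_on_cong[OF refl \<phi>])
  have "?B holomorphic_on ball 0 1"
    by (intro holomorphic_intros) (use nz in auto)
  then show "\<phi> holomorphic_on ball 0 1"
    by (subst holomorphic_cong[OF refl \<phi>]) auto
  fix z assume "cmod z = 1"
  then show "cmod (\<phi> z) = 1"
    using \<phi>[of z] norm_blaschke_factor a
    by (simp add: norm_mult prod_norm[symmetric] del: norm_divide)
qed

theorem corollaryA2:
  fixes w :: complex and \<phi> :: "complex \<Rightarrow> complex"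
  assumes "w \<in> ball 0 1"
    and "finite_blaschke_product \<phi>"
  shows "distr (harmonic_measure w) (harmonic_measure w) \<phi> = harmonic_measure w \<longleftrightarrow> \<phi> w = w"
proof -
  let ?\<nu> = "harmonic_measure w"
  have w: "cmod w < 1" using assms(1) by simp
  note \<phi> = finite_blaschke_product_properties[OF assms(2)]
  have "\<phi> \<in> measurable (restrict_space borel (sphere 0 1)) (restrict_space borel (sphere 0 1))"
    by (rule measurable_restrict_space2)
       (auto simp: space_restrict_space \<phi>(3)
         intro!: borel_measurable_continuous_on_restrict continuous_on_subset[OF \<phi>(1)])
  then have meas: "\<phi> \<in> measurable ?\<nu> ?\<nu>"
    by (simp add: measurable_cong_sets[OF sets_harmonic_measure sets_harmonic_measure])
  interpret finite_measure ?\<nu> by (rule finite_measure_harmonic_measure[OF w])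
  have powm: "(\<lambda>z. z ^ n) \<in> borel_measurable ?\<nu>" for n
    unfolding measurable_cong_sets[OF sets_harmonic_measure refl]
    by (intro borel_measurable_continuous_on_restrict continuous_intros)
  have push: "(\<integral>z. z ^ n \<partial>distr ?\<nu> ?\<nu> \<phi>) = \<phi> w ^ n" for n
  proof -
    have "(\<integral>z. z ^ n \<partial>distr ?\<nu> ?\<nu> \<phi>) = (\<integral>z. \<phi> z ^ n \<partial>?\<nu>)"
      by (rule integral_distr[OF meas powm])
    also have "\<dots> = \<phi> w ^ n"
      by (rule harmonic_measure_holomorphic_integral[OF w])
         (intro continuous_intros holomorphic_intros \<phi>)+
    finally show ?thesis .
  qed
  have mom: "(\<integral>z. z ^ n \<partial>?\<nu>) = w ^ n" for n
    by (rule harmonic_measure_holomorphic_integral[OF w]) (intro continuous_intros holomorphic_intros)+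
  show ?thesis
  proof
    assume "distr ?\<nu> ?\<nu> \<phi> = ?\<nu>"
    then show "\<phi> w = w"
      using push[of 1] mom[of 1] by simp
  next
    assume "\<phi> w = w"
    then show "distr ?\<nu> ?\<nu> \<phi> = ?\<nu>"
      by (intro circle_measure_eqI_moments)
         (simp_all add: sets_harmonic_measure finite_measure_distr meas finite_measure_axioms push mom)
  qed
qed

end
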